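(* Let $A$ be a Heyting algebra with greatest element $1$. The non-empty $1$-deductive subsets of $A$ are precisely the deductive filters of intuitionistic propositional logic on $A$.
   Context: A Heyting algebra is regarded as an algebra in the signature $(\wedge,\vee,\to,0,1)$. A semicongruence on $A$ is a reflexive binary relation on $A$ which is a subalgebra of $A\times A$. For $I\subseteq A$, let $R_I$ be the least semicongruence on $A$ containing $I\times\{1\}$, and put $\mathcal D_1(I)=\{x\in A\mid y\,R_I\,x\text{ for some }y\in I\}$. The set $I$ is $1$-deductive if $\mathcal D_1(I)\subseteq I$. A deductive filter of intuitionistic propositional logic on $A$ is a subset $F\subseteq A$ such that, whenever $\Gamma\vdash\varphi$ holds in intuitionistic propositional logic and $h$ is a valuation of propositional formulas in $A$ (a homomorphism from the algebra of formulas to $A$) with $h(\gamma)\in F$ for all $\gamma\in\Gamma$, one has $h(\varphi)\in F$. *)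

theory Defs
  imports "HOL-Library.Product_Order"
begin

text \<open>The signature \<open>(\<and>, \<or>, \<rightarrow>, 0, 1)\<close> is rendered by \<open>inf\<close>, \<open>sup\<close>, \<open>himp\<close>, \<open>bot\<close>, \<open>top\<close>.\<close>

class heyting_algebra = bounded_lattice +
  fixes himp :: "'a \<Rightarrow> 'a \<Rightarrow> 'a"
  assumes le_himp_iff: "x \<le> himp y z \<longleftrightarrow> inf x y \<le> z"

text \<open>The product \<open>A \<times> B\<close>; the lattice operations on pairs are componentwise by
  \<^theory>\<open>HOL-Library.Product_Order\<close>.\<close>

instantiation prod :: (heyting_algebra, heyting_algebra) heyting_algebra
begin

definition himp_prod :: "'a \<times> 'b \<Rightarrow> 'a \<times> 'b \<Rightarrow> 'a \<times> 'b" where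
  "himp_prod p q = (himp (fst p) (fst q), himp (snd p) (snd q))"

instance
  by standard (simp add: less_eq_prod_def himp_prod_def le_himp_iff)

end

definition heyting_subalgebra :: "'a::heyting_algebra set \<Rightarrow> bool" where
  "heyting_subalgebra S \<longleftrightarrow>
     bot \<in> S \<and> top \<in> S \<and>
     (\<forall>x\<in>S. \<forall>y\<in>S. inf x y \<in> S \<and> sup x y \<in> S \<and> himp x y \<in> S)"

definition semicongruence :: "('a::heyting_algebra \<times> 'a) set \<Rightarrow> bool" where
  "semicongruence R \<longleftrightarrow> refl R \<and> heyting_subalgebra R"

definition least_semicongruence :: "'a::heyting_algebra set \<Rightarrow> ('a \<times> 'a) set" where
  "least_semicongruence I = \<Inter> {R. semicongruence R \<and> I \<times> {top} \<subseteq> R}"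

text \<open>The intersection is itself such a semicongruence, hence the least one.\<close>

lemma semicongruence_least_semicongruence: "semicongruence (least_semicongruence I)"
  unfolding least_semicongruence_def semicongruence_def heyting_subalgebra_def refl_on_def
  by blast

lemma subset_least_semicongruence: "I \<times> {top} \<subseteq> least_semicongruence I"
  unfolding least_semicongruence_def by blast

lemma least_semicongruence_subset:
  "semicongruence R \<Longrightarrow> I \<times> {top} \<subseteq> R \<Longrightarrow> least_semicongruence I \<subseteq> R"
  unfolding least_semicongruence_def by blast

definition D1 :: "'a::heyting_algebra set \<Rightarrow> 'a set" where
  "D1 I = {x. \<exists>y\<in>I. (y, x) \<in> least_semicongruence I}"

definition one_deductive :: "'a::heyting_algebra set \<Rightarrow> bool" where
  "one_deductive I \<longleftrightarrow> D1 I \<subseteq> I"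

datatype form =
    Var nat
  | Falsum
  | Verum
  | Conj form form
  | Disj form form
  | Imp form form

text \<open>Derivability \<open>\<Gamma> \<turnstile> \<phi>\<close> from an arbitrary, possibly infinite, set of premises, in the usual
  Hilbert calculus with modus ponens.\<close>

inductive ipc :: "form set \<Rightarrow> form \<Rightarrow> bool" for \<Gamma> :: "form set" where
  premise: "\<phi> \<in> \<Gamma> \<Longrightarrow> ipc \<Gamma> \<phi>"
| K: "ipc \<Gamma> (Imp \<phi> (Imp \<psi> \<phi>))"
| S: "ipc \<Gamma> (Imp (Imp \<phi> (Imp \<psi> \<chi>)) (Imp (Imp \<phi> \<psi>) (Imp \<phi> \<chi>)))"
| conj_elim1: "ipc \<Gamma> (Imp (Conj \<phi> \<psi>) \<phi>)"
| conj_elim2: "ipc \<Gamma> (Imp (Conj \<phi> \<psi>) \<psi>)"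
| conj_intro: "ipc \<Gamma> (Imp \<phi> (Imp \<psi> (Conj \<phi> \<psi>)))"
| disj_intro1: "ipc \<Gamma> (Imp \<phi> (Disj \<phi> \<psi>))"
| disj_intro2: "ipc \<Gamma> (Imp \<psi> (Disj \<phi> \<psi>))"
| disj_elim: "ipc \<Gamma> (Imp (Imp \<phi> \<chi>) (Imp (Imp \<psi> \<chi>) (Imp (Disj \<phi> \<psi>) \<chi>)))"
| falsum_elim: "ipc \<Gamma> (Imp Falsum \<phi>)"
| verum: "ipc \<Gamma> Verum"
| mp: "ipc \<Gamma> (Imp \<phi> \<psi>) \<Longrightarrow> ipc \<Gamma> \<phi> \<Longrightarrow> ipc \<Gamma> \<psi>"

definition valuation :: "(form \<Rightarrow> 'a::heyting_algebra) \<Rightarrow> bool" where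
  "valuation h \<longleftrightarrow>
     h Falsum = bot \<and> h Verum = top \<and>
     (\<forall>\<phi> \<psi>. h (Conj \<phi> \<psi>) = inf (h \<phi>) (h \<psi>)) \<and>
     (\<forall>\<phi> \<psi>. h (Disj \<phi> \<psi>) = sup (h \<phi>) (h \<psi>)) \<and>
     (\<forall>\<phi> \<psi>. h (Imp \<phi> \<psi>) = himp (h \<phi>) (h \<psi>))"

definition deductive_filter :: "'a::heyting_algebra set \<Rightarrow> bool" where
  "deductive_filter F \<longleftrightarrow>
     (\<forall>\<Gamma> \<phi> h. ipc \<Gamma> \<phi> \<longrightarrow> valuation h \<longrightarrow> (\<forall>\<gamma>\<in>\<Gamma>. h \<gamma> \<in> F) \<longrightarrow> h \<phi> \<in> F)"

end

theory Submission
  imports Defs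
begin

text \<open>
  Both families turn out to be the filters of the lattice \<open>A\<close>: the non-empty up-sets closed under
  binary meets.

  Every pair \<open>(x, 1)\<close> with \<open>x \<in> I\<close> lies in \<open>R\<^sub>I\<close>, and so do the pairs obtained from it by operating
  with the diagonal. Meeting it with \<open>(y, y)\<close> for \<open>x \<le> y\<close> gives \<open>(x, y)\<close>, so that a 1-deductive set
  is an up-set; letting it imply \<open>(x \<and> y, x \<and> y)\<close> gives \<open>(x \<rightarrow> (x \<and> y), x \<and> y)\<close>, whose first
  entry lies above \<open>y\<close>, so that a 1-deductive set is closed under meets. Conversely, a filter \<open>F\<close>
  yields the congruence that identifies two elements when they agree below some member of \<open>F\<close>. It is
  a semicongruence containing \<open>F \<times> {1}\<close>, and it relates members of \<open>F\<close> to members of \<open>F\<close> only, hence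
  so does the smaller relation \<open>R\<^sub>F\<close>.

  That filters are deductive filters is soundness of the Hilbert calculus: axioms take the
  value \<open>1\<close> and modus ponens preserves \<open>F\<close>. That deductive filters are filters follows from applying
  the definition to the rules \<open>p \<turnstile> p \<or> q\<close> and \<open>p, q \<turnstile> p \<and> q\<close> and to the theorem \<open>\<top>\<close>.
\<close>

definition lattice_filter :: "'a::bounded_lattice set \<Rightarrow> bool" where
  "lattice_filter F \<longleftrightarrow>
     F \<noteq> {} \<and> (\<forall>x\<in>F. \<forall>y. x \<le> y \<longrightarrow> y \<in> F) \<and> (\<forall>x\<in>F. \<forall>y\<in>F. inf x y \<in> F)"

lemma lattice_filter_upward: "lattice_filter F \<Longrightarrow> x \<in> F \<Longrightarrow> x \<le> y \<Longrightarrow> y \<in> F"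
  unfolding lattice_filter_def by blast

lemma lattice_filter_inf: "lattice_filter F \<Longrightarrow> x \<in> F \<Longrightarrow> y \<in> F \<Longrightarrow> inf x y \<in> F"
  unfolding lattice_filter_def by blast

lemma lattice_filter_top: "lattice_filter F \<Longrightarrow> top \<in> F"
  unfolding lattice_filter_def using top_greatest by blast

lemma inf_himp_le: "inf (himp x y) x \<le> (y :: 'a::heyting_algebra)"
  using le_himp_iff[of "himp x y" x y] by simp

lemma himp_top_left: "himp top x = (x :: 'a::heyting_algebra)"
  using inf_himp_le[of top x] by (simp add: antisym le_himp_iff)

lemma lattice_filter_mp:
  fixes F :: "'a::heyting_algebra set"
  assumes F: "lattice_filter F" and "himp x y \<in> F" and "x \<in> F"
  shows "y \<in> F"
  using lattice_filter_upward[OF F lattice_filter_inf[OF F assms(2,3)] inf_himp_le] .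

section \<open>Filters and 1-deductive sets\<close>

text \<open>Bounding two elements relative to a member of \<open>F\<close> on each side, rather than asking for equal
  meets with it, makes each closure property a pair of inequalities, to which adjunction applies.\<close>

definition filter_congruence :: "'a::heyting_algebra set \<Rightarrow> ('a \<times> 'a) set" where
  "filter_congruence F = {(a, b). \<exists>f\<in>F. inf a f \<le> b \<and> inf b f \<le> a}"

lemma inf_le_inf_relative:
  fixes a b c d f g :: "'a::lattice"
  assumes "inf a f \<le> b" and "inf c g \<le> d"
  shows "inf (inf a c) (inf f g) \<le> inf b d"
  using inf_mono[OF assms] by (simp add: ac_simps)

text \<open>Adjunction turns the claim into a bound on \<open>sup a c\<close> itself, which replaces an appeal to
  distributivity.\<close>

lemma sup_le_sup_relative:
  fixes a b c d f g :: "'a::heyting_algebra"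
  assumes "inf a f \<le> b" and "inf c g \<le> d"
  shows "inf (sup a c) (inf f g) \<le> sup b d"
proof -
  have "inf a (inf f g) \<le> sup b d"
    using assms(1) by (metis inf.coboundedI1 inf.assoc le_supI1)
  moreover have "inf c (inf f g) \<le> sup b d"
    using assms(2) by (metis inf.coboundedI1 inf.assoc inf.commute le_supI2)
  ultimately have "sup a c \<le> himp (inf f g) (sup b d)"
    by (intro le_supI) (simp_all only: le_himp_iff)
  then show ?thesis
    by (simp add: le_himp_iff)
qed

lemma himp_le_himp_relative:
  fixes a b c d f g :: "'a::heyting_algebra"
  assumes "inf c f \<le> a" and "inf b g \<le> d"
  shows "inf (himp a b) (inf f g) \<le> himp c d"
proof -
  let ?u = "inf (inf (himp a b) (inf f g)) c"
  have "?u \<le> inf c f"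
    by (simp add: inf.coboundedI1 inf.coboundedI2)
  then have "?u \<le> inf (himp a b) a"
    using assms(1) by (meson inf.bounded_iff inf_le1 order_trans)
  then have "?u \<le> b"
    using inf_himp_le order_trans by blast
  then have "?u \<le> inf b g"
    by (simp add: inf.coboundedI1 inf.coboundedI2)
  then show ?thesis
    using assms(2) by (meson le_himp_iff order_trans)
qed

lemma semicongruence_filter_congruence:
  assumes F: "lattice_filter F"
  shows "semicongruence (filter_congruence F)"
proof -
  have refl: "(a, a) \<in> filter_congruence F" for a
    using lattice_filter_top[OF F] by (auto simp: filter_congruence_def)
  have "inf p q \<in> filter_congruence F \<and> sup p q \<in> filter_congruence F
      \<and> himp p q \<in> filter_congruence F"
    if p: "p \<in> filter_congruence F" and q: "q \<in> filter_congruence F" for p q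
  proof -
    obtain a b c d where pq: "p = (a, b)" "q = (c, d)" by fastforce
    obtain f where f: "f \<in> F" "inf a f \<le> b" "inf b f \<le> a"
      using p pq by (auto simp: filter_congruence_def)
    obtain g where g: "g \<in> F" "inf c g \<le> d" "inf d g \<le> c"
      using q pq by (auto simp: filter_congruence_def)
    have "inf f g \<in> F"
      using lattice_filter_inf[OF F] f g by blast
    then show ?thesis
      using inf_le_inf_relative[OF f(2) g(2)] inf_le_inf_relative[OF f(3) g(3)]
        sup_le_sup_relative[OF f(2) g(2)] sup_le_sup_relative[OF f(3) g(3)]
        himp_le_himp_relative[OF f(3) g(2)] himp_le_himp_relative[OF f(2) g(3)]
      by (auto simp: pq filter_congruence_def himp_prod_def)
  qed
  then show ?thesis
    using refl
    by (simp add: semicongruence_def heyting_subalgebra_def refl_on_def bot_prod_def top_prod_def)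
qed

lemma one_deductive_if_lattice_filter:
  assumes F: "lattice_filter F"
  shows "one_deductive F"
proof -
  have "F \<times> {top} \<subseteq> filter_congruence F"
    by (auto simp: filter_congruence_def)
  then have least: "least_semicongruence F \<subseteq> filter_congruence F"
    using semicongruence_filter_congruence[OF F] by (rule least_semicongruence_subset[rotated])
  have "x \<in> F" if y: "y \<in> F" and yx: "(y, x) \<in> least_semicongruence F" for x y
  proof -
    obtain f where "f \<in> F" "inf y f \<le> x"
      using yx least by (auto simp: filter_congruence_def)
    then show ?thesis
      using y lattice_filter_inf[OF F] lattice_filter_upward[OF F] by blast
  qed
  then show ?thesis
    by (auto simp: one_deductive_def D1_def)
qed

lemma lattice_filter_if_one_deductive:
  fixes I :: "'a::heyting_algebra set"
  assumes ne: "I \<noteq> {}" and ded: "one_deductive I"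
  shows "lattice_filter I"
proof -
  let ?R = "least_semicongruence I"
  have closed: "x \<in> I" if "y \<in> I" "(y, x) \<in> ?R" for x y
    using ded that by (auto simp: one_deductive_def D1_def)
  have refl: "(x, x) \<in> ?R" for x
    using semicongruence_least_semicongruence by (auto simp: semicongruence_def refl_on_def)
  have inf: "inf p q \<in> ?R" and himp: "himp p q \<in> ?R" if "p \<in> ?R" "q \<in> ?R" for p q
    using semicongruence_least_semicongruence[of I] that
    by (auto simp: semicongruence_def heyting_subalgebra_def)
  have top: "(x, top) \<in> ?R" if "x \<in> I" for x
    using subset_least_semicongruence that by blast
  have upward: "y \<in> I" if "x \<in> I" "x \<le> y" for x y
    using inf[OF top[OF that(1)] refl[of y]] closed that by (simp add: inf_absorb1)
  have meets: "inf x y \<in> I" if x: "x \<in> I" and y: "y \<in> I" for x y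
  proof -
    have "(himp x (inf x y), inf x y) \<in> ?R"
      using himp[OF top[OF x] refl[of "inf x y"]] by (simp add: himp_prod_def himp_top_left)
    moreover have "himp x (inf x y) \<in> I"
      using upward[OF y] by (simp add: le_himp_iff)
    ultimately show ?thesis
      by (rule closed[rotated])
  qed
  show ?thesis
    using ne upward meets by (auto simp: lattice_filter_def)
qed

section \<open>Filters and deductive filters\<close>

lemma himp_eq_top_iff: "himp x y = top \<longleftrightarrow> x \<le> (y :: 'a::heyting_algebra)"
  using le_himp_iff[of top x y] by (simp add: top_le top_unique)

text \<open>Soundness of the Hilbert calculus, relative to a filter. An axiom that is an
  implication takes the value \<open>top\<close> because, by adjunction, that amounts to an inequality.\<close>

lemma deductive_filter_if_lattice_filter:
  fixes F :: "'a::heyting_algebra set"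
  assumes F: "lattice_filter F"
  shows "deductive_filter F"
  unfolding deductive_filter_def
proof (intro allI impI)
  fix \<Gamma> \<phi> and h :: "form \<Rightarrow> 'a"
  assume "ipc \<Gamma> \<phi>" and h: "valuation h" and prem: "\<forall>\<gamma>\<in>\<Gamma>. h \<gamma> \<in> F"
  have hom: "h Falsum = bot" "h Verum = top"
    "\<And>\<phi> \<psi>. h (Conj \<phi> \<psi>) = inf (h \<phi>) (h \<psi>)"
    "\<And>\<phi> \<psi>. h (Disj \<phi> \<psi>) = sup (h \<phi>) (h \<psi>)"
    "\<And>\<phi> \<psi>. h (Imp \<phi> \<psi>) = himp (h \<phi>) (h \<psi>)"
    using h by (auto simp: valuation_def)
  have axiom: "h (Imp \<alpha> \<beta>) \<in> F" if "h \<alpha> \<le> h \<beta>" for \<alpha> \<beta>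
  proof -
    have "h (Imp \<alpha> \<beta>) = top"
      using that by (simp add: hom himp_eq_top_iff)
    then show ?thesis
      using lattice_filter_top[OF F] by simp
  qed
  show "h \<phi> \<in> F"
    using \<open>ipc \<Gamma> \<phi>\<close>
  proof induction
    case (premise \<phi>)
    then show ?case using prem by blast
  next
    case (S \<phi> \<psi> \<chi>)
    let ?u = "inf (inf (himp (h \<phi>) (himp (h \<psi>) (h \<chi>))) (himp (h \<phi>) (h \<psi>))) (h \<phi>)"
    have "?u \<le> inf (himp (h \<phi>) (himp (h \<psi>) (h \<chi>))) (h \<phi>)"
      and "?u \<le> inf (himp (h \<phi>) (h \<psi>)) (h \<phi>)"
      by (simp_all add: inf.coboundedI1)
    then have "?u \<le> himp (h \<psi>) (h \<chi>)" and "?u \<le> h \<psi>"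
      using inf_himp_le order_trans by blast+
    then have "?u \<le> h \<chi>"
      by (metis inf.absorb1 le_himp_iff)
    then show ?case
      by (intro axiom) (simp add: hom le_himp_iff)
  next
    case (disj_elim \<phi> \<chi> \<psi>)
    let ?l = "himp (h \<phi>) (h \<chi>)" and ?r = "himp (h \<psi>) (h \<chi>)"
    have "inf (h \<phi>) ?l \<le> h \<chi>" and "inf (h \<psi>) ?r \<le> h \<chi>"
      using inf_himp_le by (metis inf.commute)+
    then have "inf (sup (h \<phi>) (h \<psi>)) (inf ?l ?r) \<le> h \<chi>"
      using sup_le_sup_relative[of "h \<phi>" ?l "h \<chi>" "h \<psi>" ?r "h \<chi>"] by simp
    then have "inf (inf ?l ?r) (sup (h \<phi>) (h \<psi>)) \<le> h \<chi>"
      by (simp add: inf.commute)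
    then show ?case
      by (intro axiom) (simp add: hom le_himp_iff)
  next
    case verum
    then show ?case using lattice_filter_top[OF F] by (simp add: hom)
  next
    case (mp \<phi> \<psi>)
    then show ?case using lattice_filter_mp[OF F] by (simp add: hom)
  qed (rule axiom, simp add: hom le_himp_iff)+
qed

primrec eval_form :: "(nat \<Rightarrow> 'a::heyting_algebra) \<Rightarrow> form \<Rightarrow> 'a" where
  "eval_form v (Var n) = v n"
| "eval_form v Falsum = bot"
| "eval_form v Verum = top"
| "eval_form v (Conj \<phi> \<psi>) = inf (eval_form v \<phi>) (eval_form v \<psi>)"
| "eval_form v (Disj \<phi> \<psi>) = sup (eval_form v \<phi>) (eval_form v \<psi>)"
| "eval_form v (Imp \<phi> \<psi>) = himp (eval_form v \<phi>) (eval_form v \<psi>)"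

lemma valuation_eval_form: "valuation (eval_form v)"
  by (simp add: valuation_def)

lemma lattice_filter_if_deductive_filter:
  fixes F :: "'a::heyting_algebra set"
  assumes F: "deductive_filter F"
  shows "lattice_filter F"
proof -
  have rule: "eval_form v \<phi> \<in> F" if "ipc \<Gamma> \<phi>" "\<forall>\<gamma>\<in>\<Gamma>. eval_form v \<gamma> \<in> F" for \<Gamma> \<phi> v
    using F that valuation_eval_form unfolding deductive_filter_def by blast
  let ?p = "Var 0" and ?q = "Var 1"
  have "top \<in> F"
    using rule[OF ipc.verum, of "{}"] by simp
  moreover have "y \<in> F" if "x \<in> F" "x \<le> y" for x y
  proof -
    have "ipc {?p} (Disj ?p ?q)"
      by (rule ipc.mp[OF ipc.disj_intro1 ipc.premise]) simp
    \<comment> \<open>As \<open>x \<le> y\<close>, the value \<open>sup x y\<close> of the conclusion is \<open>y\<close>.\<close>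
    from rule[OF this, of "\<lambda>n. if n = 0 then x else y"] show ?thesis
      using that by (simp add: sup_absorb2)
  qed
  moreover have "inf x y \<in> F" if "x \<in> F" "y \<in> F" for x y
  proof -
    have "ipc {?p, ?q} (Conj ?p ?q)"
      by (rule ipc.mp[OF ipc.mp[OF ipc.conj_intro ipc.premise] ipc.premise]) simp_all
    from rule[OF this, of "\<lambda>n. if n = 0 then x else y"] show ?thesis
      using that by simp
  qed
  ultimately show ?thesis
    by (auto simp: lattice_filter_def)
qed

theorem theorem2p8:
  "{I :: 'a::heyting_algebra set. I \<noteq> {} \<and> one_deductive I} = {F. deductive_filter F}"
proof -
  have "I \<noteq> {} \<and> one_deductive I \<longleftrightarrow> lattice_filter I" for I :: "'a set"
    using one_deductive_if_lattice_filter lattice_filter_if_one_deductive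
      lattice_filter_top by blast
  moreover have "deductive_filter F \<longleftrightarrow> lattice_filter F" for F :: "'a set"
    using deductive_filter_if_lattice_filter lattice_filter_if_deductive_filter by blast
  ultimately show ?thesis
    by simp
qed

end
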